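(* Let $n\ge 2$ and let $c$ be a Coxeter element of the affine symmetric group $\widehat{\mathfrak S}_n$, with associated sets $\overline{L_c},\overline{R_c}\subset\mathbb Z$ (defined in the context). Let $w\in\widehat{\mathfrak S}_n$. Then $w$ is $c$-sortable if and only if the one-line notation of $w$ avoids the two following patterns: (i) $k\,i\,j$ with $i,j,k\in\mathbb Z$, $i<j<k$ and $j\in\overline{L_c}$; (ii) $j\,k\,i$ with $i,j,k\in\mathbb Z$, $i<j<k$ and $j\in\overline{R_c}$.
   Context: The affine symmetric group $\widehat{\mathfrak S}_n$ is the group of bijections $w:\mathbb Z\to\mathbb Z$ with $w(k+n)=w(k)+n$ for all $k$ and $\sum_{k=1}^n w(k)=\sum_{k=1}^n k$. It is a Coxeter group of type $\widetilde A_{n-1}$ with simple generators $s_i=(i,i+1)$, $i=0,\dots,n-1$, where for integers $a\not\equiv b \pmod n$ the affine transposition $(a,b)$ exchanges $a+mn$ and $b+mn$ for every $m\in\mathbb Z$ and fixes all other integers (so $s_0=(0,1)$). A Coxeter element is a product of $s_0,\dots,s_{n-1}$, each exactly once, in some order. For a Coxeter element $c$ one has $c(i)\neq i$ for all $i\in\mathbb Z$; set $\overline{L_c}=\{i\in\mathbb Z: c(i)>i\}$ and $\overline{R_c}=\{i\in\mathbb Z:c(i)<i\}$ (these are invariant under translation by $n$, partition $\mathbb Z$, and both meet $\{1,\dots,n\}$). The one-line notation of $w$ is the bi-infinite sequence $\cdots w(-1)\,w(0)\,w(1)\,w(2)\cdots$; it contains the pattern $k\,i\,j$ (resp. $j\,k\,i$)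 if these values occur in this left-to-right order (not necessarily consecutively). $c$-sortability: fix a reduced word $c=u_1\cdots u_n$ and let $c^\infty=u_1\cdots u_n\,u_1\cdots u_n\cdots$. Among all reduced words of $w$, the $c$-sorting word of $w$ is the one occurring as a subword of $c^\infty$ at the lexicographically first set of positions. Write it as $c_{K_1}c_{K_2}\cdots c_{K_m}$ where $c_{K_r}$ is the subword of the $r$-th copy of $u_1\cdots u_n$ consisting of the letters in $K_r\subseteq\{s_0,\dots,s_{n-1}\}$; $w$ is $c$-sortable if $K_1\supseteq K_2\supseteq\cdots\supseteq K_m$ (this does not depend on the chosen reduced word of $c$). *)

theory Defs
  imports Main "HOL-Number_Theory.Cong"
begin

definition affine_sym :: "nat \<Rightarrow> (int \<Rightarrow> int) set" where
  "affine_sym n = {w. bij w \<and> (\<forall>k. w (k + int n) = w k + int n) \<and>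
     (\<Sum>k = 1..int n. w k) = (\<Sum>k = 1..int n. k)}"

text \<open>Meaningful only for \<open>a\<close>, \<open>b\<close> incongruent modulo \<open>n\<close>.\<close>
definition affine_transp :: "nat \<Rightarrow> int \<Rightarrow> int \<Rightarrow> int \<Rightarrow> int" where
  "affine_transp n a b x =
     (if [x = a] (mod int n) then x - a + b
      else if [x = b] (mod int n) then x - b + a
      else x)"

definition simple_gen :: "nat \<Rightarrow> nat \<Rightarrow> int \<Rightarrow> int" where
  "simple_gen n i = affine_transp n (int i) (int i + 1)"

text \<open>Words in the simple generators are lists of indices below \<open>n\<close>. The word
  \<open>[i\<^sub>1, \<dots>, i\<^sub>l]\<close> evaluates to \<open>s\<^bsub>i\<^sub>1\<^esub> \<circ> \<dots> \<circ> s\<^bsub>i\<^sub>l\<^esub>\<close>: the rightmost letter acts first.\<close>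
definition word_prod :: "nat \<Rightarrow> nat list \<Rightarrow> int \<Rightarrow> int" where
  "word_prod n us = foldr (\<lambda>i f. simple_gen n i \<circ> f) us id"

definition is_word_of :: "nat \<Rightarrow> (int \<Rightarrow> int) \<Rightarrow> nat list \<Rightarrow> bool" where
  "is_word_of n w us \<longleftrightarrow> set us \<subseteq> {..<n} \<and> word_prod n us = w"

definition reduced_word :: "nat \<Rightarrow> (int \<Rightarrow> int) \<Rightarrow> nat list \<Rightarrow> bool" where
  "reduced_word n w us \<longleftrightarrow>
     is_word_of n w us \<and> (\<forall>vs. is_word_of n w vs \<longrightarrow> length us \<le> length vs)"

definition coxeter_element :: "nat \<Rightarrow> (int \<Rightarrow> int) \<Rightarrow> bool" where
  "coxeter_element n c \<longleftrightarrow> (\<exists>us. distinct us \<and> set us = {..<n} \<and> c = word_prod n us)"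

definition L_set :: "(int \<Rightarrow> int) \<Rightarrow> int set" where
  "L_set c = {i. c i > i}"

definition R_set :: "(int \<Rightarrow> int) \<Rightarrow> int set" where
  "R_set c = {i. c i < i}"

text \<open>Position \<open>p\<close> (counted from 0) of the infinite word \<open>us us us \<dots>\<close>; it lies in
  copy number \<open>p div length us\<close> (counted from 0) of \<open>us\<close>.\<close>
definition inf_word :: "nat list \<Rightarrow> nat \<Rightarrow> nat" where
  "inf_word us p = us ! (p mod length us)"

text \<open>A finite set of positions is given by its strictly increasing enumeration.\<close>
definition reduced_positions :: "nat \<Rightarrow> nat list \<Rightarrow> (int \<Rightarrow> int) \<Rightarrow> nat list \<Rightarrow> bool" where
  "reduced_positions n us w ps \<longleftrightarrow>
     sorted_wrt (<) ps \<and> reduced_word n w (map (inf_word us) ps)"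

definition sorting_positions :: "nat \<Rightarrow> nat list \<Rightarrow> (int \<Rightarrow> int) \<Rightarrow> nat list \<Rightarrow> bool" where
  "sorting_positions n us w ps \<longleftrightarrow>
     reduced_positions n us w ps \<and>
     (\<forall>qs. reduced_positions n us w qs \<longrightarrow> ps = qs \<or> (ps, qs) \<in> lexord less_than)"

definition copy_letters :: "nat list \<Rightarrow> nat list \<Rightarrow> nat \<Rightarrow> nat set" where
  "copy_letters us ps r = inf_word us ` {p \<in> set ps. p div length us = r}"

text \<open>Sortability with respect to a Coxeter element, relative to a chosen reduced
  word \<open>us\<close> of that element. All \<open>copy_letters us ps r\<close> beyond the last used copy are empty.\<close>
definition sortable :: "nat \<Rightarrow> nat list \<Rightarrow> (int \<Rightarrow> int) \<Rightarrow> bool" where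
  "sortable n us w \<longleftrightarrow>
     (\<exists>ps. sorting_positions n us w ps \<and>
        (\<forall>r. copy_letters us ps (Suc r) \<subseteq> copy_letters us ps r))"

definition occurs_in_order :: "(int \<Rightarrow> int) \<Rightarrow> int \<Rightarrow> int \<Rightarrow> int \<Rightarrow> bool" where
  "occurs_in_order w x y z \<longleftrightarrow> (\<exists>p q r. p < q \<and> q < r \<and> w p = x \<and> w q = y \<and> w r = z)"

end

theory Submission
  imports Defs
begin

text \<open>The length of an element is its number of inversions up to translation, so the
  sorting word is found greedily: reading the infinite word letter by letter, a letter is taken
  exactly when it is a left descent of what remains. Call a value low or high according to its
  membership in \<open>R_set\<close> or \<open>L_set\<close> of the Coxeter element spelled by the next \<open>n\<close> letters; the
  side of \<open>j\<close> records which of the letters \<open>j - 1\<close>, \<open>j\<close> comes first. If the next letter is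
  \<open>a\<close>, then \<open>a\<close> is low and \<open>a + 1\<close> is high, and passing over it exchanges the two sides.

  If \<open>a\<close> is a descent, multiplying by the reflection carries patterns to patterns of the rotated
  Coxeter element. If it is not, \<open>a\<close> stands left of \<open>a + 1\<close>, and avoidance forces every
  value at most \<open>a\<close> to stand left of every value above \<open>a\<close>; hence \<open>w\<close> lies in the parabolic
  subgroup without the letter \<open>a\<close>, which is therefore never used again. In that subgroup the
  sides of \<open>a\<close> and \<open>a + 1\<close> no longer matter. So avoidance together with membership in the
  parabolic subgroup of the letters not yet skipped is invariant under each greedy step.\<close>

subsection \<open>Simple reflections and affine permutations\<close>

lemma simple_gen_eq:
  "simple_gen n a x = (if int n dvd x - int a then x + 1
     else if int n dvd x - int a - 1 then x - 1 else x)"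
  by (simp add: simple_gen_def affine_transp_def cong_iff_dvd_diff algebra_simps)

lemma dvd_small_eq:
  assumes "int n dvd x - y" "\<bar>x - y\<bar> < int n"
  shows "x = y"
  using assms zdvd_not_zless[of "x - y" "int n"] zdvd_not_zless[of "y - x" "int n"]
  by (smt (verit) dvd_diff_commute)

lemma not_dvd_consecutive:
  assumes "n \<ge> 2" "int n dvd x"
  shows "\<not> int n dvd x + 1" "\<not> int n dvd x - 1"
proof -
  have "\<not> int n dvd 1" using assms(1) by simp
  then show "\<not> int n dvd x + 1" "\<not> int n dvd x - 1"
    using assms(2) dvd_add_right_iff[of "int n" x 1] dvd_diff_right_iff[of "int n" x 1] by blast+
qed

lemma simple_gen_invol:
  assumes "n \<ge> 2"
  shows "simple_gen n a (simple_gen n a x) = x"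
  using not_dvd_consecutive[OF assms, of "x - int a"]
    not_dvd_consecutive[OF assms, of "x - int a - 1"]
  by (auto simp: simple_gen_eq algebra_simps)

lemma simple_gen_comp_invol:
  assumes "n \<ge> 2"
  shows "simple_gen n a \<circ> (simple_gen n a \<circ> w) = w"
  using simple_gen_invol[OF assms] by auto

text \<open>A simple reflection moves each value by at most one, so the only pairs whose order it
  can change are the neighbours it exchanges.\<close>

lemma simple_gen_mono:
  assumes "n \<ge> 2" "x < y"
  shows "simple_gen n a x < simple_gen n a y \<or> y = x + 1 \<and> int n dvd x - int a"
proof (cases "int n dvd x - int a")
  case True
  show ?thesis
  proof (cases "int n dvd y - int a - 1")
    case yd: True
    then have "int n dvd (y - int a - 1) - (x - int a)"
      using True by (rule dvd_diff)
    then have "int n dvd y - (x + 1)"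
      by (simp add: algebra_simps)
    \<comment> \<open>At distance at least \<open>n + 1\<close>, the two values may each move one
      step towards the other and still keep their order.\<close>
    then have "y = x + 1 \<or> y - (x + 1) \<ge> int n"
      using assms dvd_small_eq[of n y "x + 1"] by fastforce
    with True yd assms show ?thesis
      by (auto simp: simple_gen_eq)
  next
    case False
    then have "y \<noteq> x + 1" using True by auto
    with True False assms show ?thesis
      by (auto simp: simple_gen_eq)
  qed
next
  case False
  have "int n dvd y - int a - 1 \<Longrightarrow> y \<noteq> x + 1"
    using False by auto
  with False assms show ?thesis
    by (auto simp: simple_gen_eq)
qed

text \<open>Crossing the cut between \<open>t\<close> and \<open>t + 1\<close> requires exchanging
  these two values. Parabolic subgroups can therefore be described by the cuts they respect.\<close>

lemma simple_gen_cut: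
  assumes "\<not> int n dvd t - int a"
  shows "simple_gen n a x \<le> t \<longleftrightarrow> x \<le> t"
  using assms by (auto simp: simple_gen_eq) (smt (verit))+

section \<open>Periodicity, windows, and closure under simple reflections\<close>

lemma affine_symD:
  assumes "w \<in> affine_sym n"
  shows "bij w" "w (k + int n) = w k + int n"
    "(\<Sum>k = 1..int n. w k) = (\<Sum>k = 1..int n. k)"
  using assms by (auto simp: affine_sym_def)

lemma affine_sym_eq_iff:
  "w \<in> affine_sym n \<Longrightarrow> w x = w y \<longleftrightarrow> x = y"
  using affine_symD(1) by (metis bij_is_inj injD)

lemma affine_sym_shift:
  assumes "w \<in> affine_sym n"
  shows "w (k + m * int n) = w k + m * int n"
proof -
  have nat: "w (k + int j * int n) = w k + int j * int n" for j k
  proof (induction j)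
    case (Suc j)
    have "w (k + int (Suc j) * int n) = w ((k + int j * int n) + int n)"
      by (simp add: algebra_simps)
    then show ?case
      using Suc affine_symD(2)[OF assms, of "k + int j * int n"] by (simp add: algebra_simps)
  qed simp
  show ?thesis
  proof (cases "m \<ge> 0")
    case True
    then show ?thesis using nat[of k "nat m"] by simp
  next
    case False
    then show ?thesis using nat[of "k + m * int n" "nat (- m)"] by simp
  qed
qed

lemma ex_shift_in_window:
  assumes "n \<ge> 2"
  shows "\<exists>m. 1 \<le> x + m * int n \<and> x + m * int n \<le> int n"
proof -
  have "x + (- ((x - 1) div int n)) * int n = (x - 1) mod int n + 1"
    by (smt (verit) minus_mult_minus mod_div_mult_eq mult_minus_left)
  moreover have "0 \<le> (x - 1) mod int n" "(x - 1) mod int n < int n"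
    using assms by auto
  ultimately show ?thesis by (metis add1_zle_eq le_add_same_cancel2 add.commute)
qed

lemma affine_sym_window_unique:
  assumes "w \<in> affine_sym n"
    and "1 \<le> p" "p \<le> int n" "1 \<le> q" "q \<le> int n" "int n dvd w p - w q"
  shows "p = q"
proof -
  obtain m where "w p - w q = int n * m" using assms(6) by auto
  then have "w p = w (q + m * int n)"
    using affine_sym_shift[OF assms(1)] by (simp add: algebra_simps)
  then have "p = q + m * int n"
    using affine_sym_eq_iff[OF assms(1)] by blast
  then show ?thesis
    using dvd_small_eq[of n p q] assms by simp
qed

lemma affine_sym_window_ex:
  assumes "n \<ge> 2" "w \<in> affine_sym n"
  shows "\<exists>p. 1 \<le> p \<and> p \<le> int n \<and> int n dvd w p - t"
proof -
  obtain x where x: "w x = t" using affine_symD(1)[OF assms(2)] by (metis bij_pointE)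
  obtain m where "1 \<le> x + m * int n" "x + m * int n \<le> int n"
    using ex_shift_in_window[OF assms(1)] by blast
  then show ?thesis
    using x affine_sym_shift[OF assms(2), of x m] by (metis add_diff_cancel_left' dvd_triv_right)
qed

lemma simple_gen_shift:
  "simple_gen n a (x + int n) = simple_gen n a x + int n"
proof -
  have "int n dvd x + int n - b \<longleftrightarrow> int n dvd x - b" for b
    using dvd_add_triv_right_iff[of "int n" "x - b"] by (simp add: algebra_simps)
  from this[of "int a"] this[of "int a + 1"] show ?thesis
    by (simp add: simple_gen_eq algebra_simps)
qed

text \<open>Exactly one window position holds a value congruent to \<open>a\<close> and exactly one
  holds a value congruent to \<open>a + 1\<close>; their changes \<open>+1\<close> and
  \<open>-1\<close> cancel in the sum.\<close>

lemma simple_gen_comp_affine_sym: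
  assumes n: "n \<ge> 2" and w: "w \<in> affine_sym n"
  shows "simple_gen n a \<circ> w \<in> affine_sym n"
proof -
  let ?s = "simple_gen n a"
  have "bij ?s" using simple_gen_invol[OF n] by (metis involuntory_imp_bij)
  then have bij: "bij (?s \<circ> w)" using affine_symD(1)[OF w] by (rule bij_comp[rotated])
  obtain p where p: "1 \<le> p" "p \<le> int n" "int n dvd w p - int a"
    using affine_sym_window_ex[OF n w] by blast
  obtain q where q: "1 \<le> q" "q \<le> int n" "int n dvd w q - (int a + 1)"
    using affine_sym_window_ex[OF n w] by blast
  have pq: "p \<noteq> q"
    using p q not_dvd_consecutive(2)[OF n p(3)] by (auto simp: algebra_simps)
  have pu: "int n dvd w x - int a \<longleftrightarrow> x = p" if "x \<in> {1..int n}" for x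
    using affine_sym_window_unique[OF w, of x p] p that dvd_diff[of "int n" "w x - int a" "w p - int a"]
    by auto
  have qu: "int n dvd w x - int a - 1 \<longleftrightarrow> x = q" if "x \<in> {1..int n}" for x
    using affine_sym_window_unique[OF w, of x q] q that
      dvd_diff[of "int n" "w x - int a - 1" "w q - (int a + 1)"]
    by (auto simp: algebra_simps)
  have "(\<Sum>x = 1..int n. (?s \<circ> w) x) =
      (\<Sum>x = 1..int n. w x + ((if x = p then 1 else 0) + (if x = q then - 1 else 0)))"
    by (rule sum.cong) (use pq pu qu in \<open>auto simp: simple_gen_eq\<close>)
  also have "\<dots> = (\<Sum>x = 1..int n. w x)"
    using p q by (simp add: sum.distrib)
  finally show ?thesis
    using bij affine_symD[OF w] by (simp add: affine_sym_def simple_gen_shift)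
qed

lemma id_affine_sym: "id \<in> affine_sym n"
  by (simp add: affine_sym_def)

text \<open>The displacement \<open>w x - x\<close> is periodic, so its maximum over one window is a
  global bound.\<close>

lemma affine_sym_bounded_displacement:
  assumes "n \<ge> 2" "w \<in> affine_sym n"
  shows "\<exists>M. \<forall>x. \<bar>w x - x\<bar> \<le> M"
proof (intro exI allI)
  fix x
  obtain m where m: "1 \<le> x + m * int n" "x + m * int n \<le> int n"
    using ex_shift_in_window[OF assms(1)] by blast
  have "\<bar>w x - x\<bar> = \<bar>w (x + m * int n) - (x + m * int n)\<bar>"
    using affine_sym_shift[OF assms(2)] by simp
  also have "\<dots> \<le> Max ((\<lambda>x. \<bar>w x - x\<bar>) ` {1..int n})"
    using m by (intro Max_ge) auto
  finally show "\<bar>w x - x\<bar> \<le> Max ((\<lambda>x. \<bar>w x - x\<bar>) ` {1..int n})" .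
qed

subsection \<open>Inversions and reduced words\<close>

text \<open>Translation by \<open>n\<close> acts on inversions; keeping \<open>p\<close> in the
  window selects one from each orbit, so the cardinality is the Coxeter length.\<close>

definition inversions :: "nat \<Rightarrow> (int \<Rightarrow> int) \<Rightarrow> (int \<times> int) set" where
  "inversions n w = {(p, q). 1 \<le> p \<and> p \<le> int n \<and> p < q \<and> w q < w p}"

text \<open>Multiplication on the left acts on values, so a left descent compares the positions of
  two adjacent values.\<close>

definition left_descent :: "(int \<Rightarrow> int) \<Rightarrow> nat \<Rightarrow> bool" where
  "left_descent w a \<longleftrightarrow> (\<exists>x y. x < y \<and> w x = int a + 1 \<and> w y = int a)"

lemma finite_inversions:
  assumes "n \<ge> 2" "w \<in> affine_sym n"
  shows "finite (inversions n w)"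
proof -
  obtain M where M: "\<forall>x. \<bar>w x - x\<bar> \<le> M"
    using affine_sym_bounded_displacement[OF assms] by blast
  have "(p, q) \<in> {1..int n} \<times> {1..int n + 2 * M}" if "(p, q) \<in> inversions n w" for p q
  proof -
    have "1 \<le> p" "p \<le> int n" "p < q" "w q < w p"
      using that by (auto simp: inversions_def)
    \<comment> \<open>This gives \<open>q \<le> w q + M < w p + M \<le> p + 2 * M\<close>.\<close>
    moreover have "\<bar>w p - p\<bar> \<le> M" "\<bar>w q - q\<bar> \<le> M" using M by auto
    ultimately show ?thesis by auto
  qed
  then have "inversions n w \<subseteq> {1..int n} \<times> {1..int n + 2 * M}"
    by (rule subrelI)
  then show ?thesis by (rule finite_subset) simp
qed

text \<open>The positions of \<open>t\<close> and \<open>t + 1\<close> arise from those of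
  \<open>int a\<close> and \<open>int a + 1\<close> by a common translation, so a descent may be
  tested at any translate.\<close>

lemma left_descent_iff_at_shift:
  assumes w: "w \<in> affine_sym n"
    and "int n dvd t - int a" "w x = t + 1" "w y = t"
  shows "left_descent w a \<longleftrightarrow> x < y"
proof -
  obtain m where m: "t = int a + m * int n"
    using assms(2) by (metis add.commute diff_add_cancel dvdE mult.commute)
  have *: "w (x + (- m) * int n) = int a + 1" "w (y + (- m) * int n) = int a"
    using assms(3,4) m unfolding affine_sym_shift[OF w] by auto
  have "x' = x + (- m) * int n \<and> y' = y + (- m) * int n" if "w x' = int a + 1" "w y' = int a" for x' y'
    using that * affine_sym_eq_iff[OF w] by metis
  then show ?thesis using * unfolding left_descent_def by (metis add_less_cancel_right)
qed

lemma left_descent_simple_gen: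
  assumes n: "n \<ge> 2" and w: "w \<in> affine_sym n"
  shows "left_descent (simple_gen n a \<circ> w) a \<longleftrightarrow> \<not> left_descent w a"
proof -
  obtain x y where xy: "w x = int a + 1" "w y = int a"
    using affine_symD(1)[OF w] by (metis bij_pointE)
  have "(simple_gen n a \<circ> w) y = int a + 1" "(simple_gen n a \<circ> w) x = int a"
    using n xy by (auto simp: simple_gen_eq)
  then have "left_descent (simple_gen n a \<circ> w) a \<longleftrightarrow> y < x"
    by (intro left_descent_iff_at_shift[OF simple_gen_comp_affine_sym[OF n w]]) simp_all
  moreover have "left_descent w a \<longleftrightarrow> x < y"
    using left_descent_iff_at_shift[OF w _ xy] by simp
  moreover have "x \<noteq> y" using xy by auto
  ultimately show ?thesis by auto
qed

text \<open>By \<open>simple_gen_mono\<close> only pairs of exchanged values change order. They form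
  a single orbit under translation, which contributes one pair with left position in the
  window.\<close>

lemma card_inversions_descent:
  assumes n: "n \<ge> 2" and w: "w \<in> affine_sym n" and d: "left_descent w a"
  shows "card (inversions n w) = Suc (card (inversions n (simple_gen n a \<circ> w)))"
proof -
  let ?s = "simple_gen n a"
  let ?v = "?s \<circ> w"
  have v: "?v \<in> affine_sym n" using simple_gen_comp_affine_sym[OF n w] .
  obtain x y where xy: "x < y" "w x = int a + 1" "w y = int a"
    using d by (auto simp: left_descent_def)
  obtain m where m: "1 \<le> x + m * int n" "x + m * int n \<le> int n"
    using ex_shift_in_window[OF n] by blast
  define p where "p = x + m * int n"
  define q where "q = y + m * int n"
  have pq: "w q = int a + m * int n" "w p = w q + 1"
    using xy affine_sym_shift[OF w] by (auto simp: p_def q_def)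
  have qd: "int n dvd w q - int a" using pq by simp
  have in1: "(p, q) \<in> inversions n w"
    using m xy pq by (auto simp: inversions_def p_def q_def)
  have "?s (w q) = w q + 1" "?s (w p) = w p - 1"
    using qd not_dvd_consecutive(1)[OF n qd] pq(2) by (auto simp: simple_gen_eq algebra_simps)
  then have notin: "(p, q) \<notin> inversions n ?v"
    using pq(2) by (auto simp: inversions_def)
  have "inversions n w = insert (p, q) (inversions n ?v)"
  proof (intro equalityI subrelI)
    fix p' q' assume i: "(p', q') \<in> inversions n w"
    then have "?s (w q') < ?s (w p') \<or> w p' = w q' + 1 \<and> int n dvd w q' - int a"
      using simple_gen_mono[OF n] by (auto simp: inversions_def)
    moreover have "(p', q') = (p, q)" if h: "w p' = w q' + 1" "int n dvd w q' - int a"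
    proof -
      have "int n dvd w p' - w p"
        using dvd_diff[OF h(2) qd] h(1) pq(2) by simp
      then have "p' = p"
        using affine_sym_window_unique[OF w] i m by (auto simp: inversions_def p_def)
      then show ?thesis using h(1) pq(2) affine_sym_eq_iff[OF w] by auto
    qed
    ultimately show "(p', q') \<in> insert (p, q) (inversions n ?v)"
      using i by (auto simp: inversions_def)
  next
    fix p' q' assume i: "(p', q') \<in> insert (p, q) (inversions n ?v)"
    show "(p', q') \<in> inversions n w"
    proof (cases "(p', q') = (p, q)")
      case False
      then have j: "(p', q') \<in> inversions n ?v" using i by blast
      then have "?s (w q') < ?s (w p')" by (auto simp: inversions_def)
      then have "w q' < w p' \<or> ?s (w p') = ?s (w q') + 1 \<and> int n dvd ?s (w q') - int a"
        using simple_gen_mono[OF n, of "?s (w q')" "?s (w p')" a] simple_gen_invol[OF n] by simp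
      \<comment> \<open>An inversion created by the reflection would have the smaller exchanged
        value on the left in \<open>w\<close>, against the descent.\<close>
      moreover have False if h: "?s (w p') = ?s (w q') + 1" "int n dvd ?s (w q') - int a"
      proof -
        have "w q' = ?s (w q') + 1" "w p' = ?s (w q')"
          using h not_dvd_consecutive(1)[OF n h(2)] simple_gen_invol[OF n, of a "w q'"]
            simple_gen_invol[OF n, of a "w p'"]
          by (auto simp: simple_gen_eq[of n a "?s (w q')"] simple_gen_eq[of n a "?s (w q') + 1"]
            algebra_simps)
        then have "q' < p'" using left_descent_iff_at_shift[OF w h(2)] d by blast
        then show False using j by (auto simp: inversions_def)
      qed
      ultimately show ?thesis using j by (auto simp: inversions_def)
    qed (use in1 in simp)
  qed
  then show ?thesis
    using notin finite_inversions[OF n v] by simp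
qed

lemma card_inversions_ascent:
  assumes n: "n \<ge> 2" and w: "w \<in> affine_sym n" and d: "\<not> left_descent w a"
  shows "card (inversions n (simple_gen n a \<circ> w)) = Suc (card (inversions n w))"
  using card_inversions_descent[OF n simple_gen_comp_affine_sym[OF n w], of a a]
    left_descent_simple_gen[OF n w, of a] d unfolding simple_gen_comp_invol[OF n] by blast

section \<open>Cuts of values and of positions\<close>

lemma affine_sym_window_sum:
  assumes w: "w \<in> affine_sym n"
  shows "(\<Sum>x = u + 1..u + int n. w x - x) = 0"
proof -
  define h where "h u = (\<Sum>x = u + 1..u + int n. w x - x)" for u
  \<comment> \<open>Sliding the window trades the displacement at \<open>u + 1\<close> for the equal
    one at \<open>u + 1 + int n\<close>.\<close>
  have step: "h (u + 1) = h u" for u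
  proof (cases "n = 0")
    case False
    then have "{u + 1 + 1..u + 1 + int n} = insert (u + 1 + int n) {u + 2..u + int n}"
      "{u + 1..u + int n} = insert (u + 1) {u + 2..u + int n}" by auto
    then show ?thesis
      using affine_symD(2)[OF w, of "u + 1"] by (simp add: h_def)
  qed (simp add: h_def)
  have "h u = h 0"
  proof (induction u rule: int_induct[where k = 0])
    case (step2 i)
    then show ?case using step[of "i - 1"] by simp
  qed (use step in simp_all)
  also have "\<dots> = 0"
    using affine_symD(3)[OF w] by (simp add: h_def sum_subtractf)
  finally show ?thesis by (simp add: h_def)
qed

lemma sum_int_window:
  "(\<Sum>x = u + 1..u + int n. x) = (\<Sum>x = 1..int n. x) + int n * u"
proof -
  have "(\<Sum>x = u + 1..u + int n. x) = (\<Sum>x = 1..int n. x + u)"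
    by (rule sum.reindex_bij_witness[where i = "\<lambda>x. x + u" and j = "\<lambda>x. x - u"]) auto
  then show ?thesis by (simp add: sum.distrib)
qed

text \<open>The normalisation of the sum forces a cut of the values that is also a cut of the
  positions to sit at the same place in both.\<close>
lemma affine_sym_cut:
  assumes n: "n \<ge> 2" and w: "w \<in> affine_sym n"
    and sep: "\<And>x y. w x \<le> t \<Longrightarrow> t < w y \<Longrightarrow> x < y"
  shows "w x \<le> t \<longleftrightarrow> x \<le> t"
proof -
  obtain x0 x1 where x01: "w x0 = t" "w x1 = t + 1"
    using affine_symD(1)[OF w] by (metis bij_pointE)
  define S where "S = {x0..x1} \<inter> {x. w x \<le> t}"
  have "x0 < x1" using sep[of x0 x1] x01 by simp
  then have S: "finite S" "x0 \<in> S" using x01 by (simp_all add: S_def)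
  \<comment> \<open>Between the positions of \<open>t\<close> and \<open>t + 1\<close>, this is the
    last position with a value at most \<open>t\<close>; by \<open>sep\<close> it locates the cut
    among the positions.\<close>
  define m where "m = Max S"
  have mS: "m \<in> S" using S Max_in unfolding m_def by blast
  have "m \<noteq> x1" using mS x01 by (auto simp: S_def)
  then have "m + 1 \<in> {x0..x1}" using mS by (auto simp: S_def)
  moreover have "m + 1 \<notin> S" using Max_ge[OF S(1), of "m + 1"] by (auto simp: m_def)
  ultimately have wm: "w m \<le> t" "t < w (m + 1)" using mS by (auto simp: S_def)
  have cut: "w x \<le> t \<longleftrightarrow> x \<le> m" for x
    using sep[of m x] sep[of x "m + 1"] wm by force
  \<comment> \<open>The upper bound comes from one period earlier, where the position is at most
    \<open>m\<close> and hence the value at most \<open>t\<close>.\<close>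
  have "w ` {m + 1..m + int n} \<subseteq> {t + 1..t + int n}"
  proof clarsimp
    fix x assume x: "m + 1 \<le> x" "x \<le> m + int n"
    have "w x = w (x - int n) + int n" using affine_symD(2)[OF w, of "x - int n"] by simp
    then show "t + 1 \<le> w x \<and> w x \<le> t + int n"
      using cut[of x] cut[of "x - int n"] x by auto
  qed
  moreover have inj: "inj_on w {m + 1..m + int n}"
    using affine_sym_eq_iff[OF w] by (auto intro: inj_onI)
  ultimately have img: "w ` {m + 1..m + int n} = {t + 1..t + int n}"
    by (intro card_subset_eq) (auto simp: card_image)
  \<comment> \<open>Displacements over a window sum to zero, so the two windows have equal sums and
    must coincide.\<close>
  have "(\<Sum>x = m + 1..m + int n. x) = (\<Sum>x = m + 1..m + int n. w x)"
    using affine_sym_window_sum[OF w, of m] by (simp add: sum_subtractf)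
  also have "\<dots> = (\<Sum>x = t + 1..t + int n. x)"
    using sum.reindex[OF inj, of "\<lambda>x. x"] img by simp
  finally have "m = t" using n by (simp add: sum_int_window)
  then show ?thesis using cut by simp
qed

text \<open>Without descents the inverse of \<open>w\<close> is increasing, so every cut of the
  values is one of the positions, and \<open>affine_sym_cut\<close> forces the identity.\<close>

lemma ex_left_descent:
  assumes n: "n \<ge> 2" and w: "w \<in> affine_sym n" and "w \<noteq> id"
  shows "\<exists>a<n. left_descent w a"
proof (rule ccontr)
  assume no: "\<not> ?thesis"
  define v where "v = inv w"
  have v: "w (v t) = t" "v (w t) = t" for t
    using affine_symD(1)[OF w] by (auto simp: v_def bij_is_inj bij_is_surj surj_f_inv_f)
  have step: "v t < v (t + 1)" for t
  proof (rule ccontr)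
    assume "\<not> v t < v (t + 1)"
    then have "v (t + 1) < v t" using v(1) by (metis add_cancel_left_right linorder_neqE one_neq_zero)
    moreover have "int n dvd t - int (nat (t mod int n))"
      using n by simp
    ultimately have "left_descent w (nat (t mod int n))"
      using left_descent_iff_at_shift[OF w] v(1) by blast
    moreover have "nat (t mod int n) < n" using n by (simp add: nat_less_iff)
    ultimately show False using no by blast
  qed
  have "v t < v (t + 1 + int k)" for t k
  proof (induction k)
    case (Suc k)
    then show ?case using step[of "t + 1 + int k"] by (simp add: algebra_simps)
  qed (use step in simp)
  then have mono: "v t < v u" if "t < u" for t u
    using that by (metis zless_iff_Suc_zadd add.assoc of_nat_Suc)
  have "w x \<le> t \<longleftrightarrow> x \<le> t" for x t
    by (rule affine_sym_cut[OF n w]) (metis mono v(2) order.strict_trans1)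
  then have "w x = x" for x by (metis order.antisym order_refl)
  then show False using assms(3) by auto
qed

section \<open>Words and length\<close>

lemma word_prod_Nil [simp]: "word_prod n [] = id"
  by (simp add: word_prod_def)

lemma word_prod_Cons: "word_prod n (a # us) = simple_gen n a \<circ> word_prod n us"
  by (simp add: word_prod_def)

lemma word_prod_append: "word_prod n (us @ vs) = word_prod n us \<circ> word_prod n vs"
  by (induction us) (simp_all only: append_Nil append_Cons word_prod_Nil word_prod_Cons comp_assoc id_comp)

lemma word_prod_affine_sym: "n \<ge> 2 \<Longrightarrow> word_prod n us \<in> affine_sym n"
  by (induction us) (simp_all only: word_prod_Nil word_prod_Cons id_affine_sym simple_gen_comp_affine_sym)

lemma inversions_id: "inversions n id = {}"
  by (auto simp: inversions_def)

lemma card_inversions_word_prod: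
  assumes n: "n \<ge> 2"
  shows "card (inversions n (word_prod n us)) \<le> length us"
proof (induction us)
  case (Cons a us)
  then show ?case
    using card_inversions_descent[OF n word_prod_affine_sym[OF n], of us a]
      card_inversions_ascent[OF n word_prod_affine_sym[OF n], of us a]
    by (cases "left_descent (word_prod n us) a") (simp_all add: word_prod_Cons del: o_apply)
qed (simp add: inversions_id del: id_apply)

text \<open>Stripping left descents one at a time reaches the identity and spends one letter per
  inversion.\<close>

lemma ex_word_card_inversions:
  assumes n: "n \<ge> 2" and "w \<in> affine_sym n"
  shows "\<exists>us. is_word_of n w us \<and> length us = card (inversions n w)"
  using assms(2)
proof (induction "card (inversions n w)" arbitrary: w rule: less_induct)
  case less
  show ?case
  proof (cases "w = id")
    case True
    then show ?thesis by (intro exI[of _ "[]"]) (simp add: is_word_of_def inversions_id)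
  next
    case False
    then obtain a where a: "a < n" "left_descent w a"
      using ex_left_descent[OF n less.prems] by blast
    let ?v = "simple_gen n a \<circ> w"
    have c: "card (inversions n w) = Suc (card (inversions n ?v))"
      using card_inversions_descent[OF n less.prems a(2)] .
    obtain us where "is_word_of n ?v us" "length us = card (inversions n ?v)"
      using less.hyps[of ?v] c simple_gen_comp_affine_sym[OF n less.prems] by auto
    then show ?thesis
      using a(1) c simple_gen_comp_invol[OF n, of a w]
      by (intro exI[of _ "a # us"]) (simp add: is_word_of_def word_prod_Cons)
  qed
qed

lemma reduced_word_iff_card_inversions:
  assumes n: "n \<ge> 2" and w: "w \<in> affine_sym n"
  shows "reduced_word n w us \<longleftrightarrow> is_word_of n w us \<and> length us = card (inversions n w)"
proof -
  obtain vs where "is_word_of n w vs" "length vs = card (inversions n w)"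
    using ex_word_card_inversions[OF assms] by blast
  moreover have "card (inversions n w) \<le> length us" if "is_word_of n w us" for us
    using that card_inversions_word_prod[OF n, of us] by (auto simp: is_word_of_def)
  ultimately show ?thesis
    unfolding reduced_word_def by (metis order.antisym)
qed

text \<open>The inversion count drops at a descent and rises at an ascent. This recursion drives the
  greedy reading of the infinite word.\<close>

lemma reduced_word_Cons:
  assumes n: "n \<ge> 2" and w: "w \<in> affine_sym n" and a: "a < n"
  shows "reduced_word n w (a # us) \<longleftrightarrow>
    left_descent w a \<and> reduced_word n (simple_gen n a \<circ> w) us"
proof -
  let ?v = "simple_gen n a \<circ> w"
  have v: "?v \<in> affine_sym n" using simple_gen_comp_affine_sym[OF n w] .
  have wd: "is_word_of n w (a # us) \<longleftrightarrow> is_word_of n ?v us"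
    unfolding is_word_of_def word_prod_Cons
    using a simple_gen_comp_invol[OF n] by (metis insert_subset lessThan_iff list.simps(15))
  show ?thesis
  proof (cases "left_descent w a")
    case True
    then show ?thesis
      using card_inversions_descent[OF n w True] wd
      by (simp add: reduced_word_iff_card_inversions[OF n w] reduced_word_iff_card_inversions[OF n v])
  next
    case False
    have "length us \<ge> card (inversions n ?v)" if "is_word_of n ?v us"
      using that card_inversions_word_prod[OF n, of us] by (auto simp: is_word_of_def)
    then show ?thesis
      using False card_inversions_ascent[OF n w False] wd
      by (auto simp: reduced_word_iff_card_inversions[OF n w])
  qed
qed

subsection \<open>Pattern avoidance\<close>

text \<open>Avoidance of both patterns, with \<open>L\<close> in the role of \<open>L_set c\<close> and its complement
  in the role of \<open>R_set c\<close>.\<close>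
definition aligned :: "int set \<Rightarrow> (int \<Rightarrow> int) \<Rightarrow> bool" where
  "aligned L w \<longleftrightarrow> (\<forall>p q r. p < q \<longrightarrow> q < r \<longrightarrow>
     \<not> (w q < w r \<and> w r < w p \<and> w r \<in> L) \<and> \<not> (w r < w p \<and> w p < w q \<and> w p \<notin> L))"

lemma alignedD:
  assumes "aligned L w" "p < q" "q < r"
  shows "w q < w r \<Longrightarrow> w r < w p \<Longrightarrow> w r \<in> L \<Longrightarrow> False"
    "w r < w p \<Longrightarrow> w p < w q \<Longrightarrow> w p \<notin> L \<Longrightarrow> False"
  using assms unfolding aligned_def by blast+

lemma alignedI:
  assumes "\<And>p q r. p < q \<Longrightarrow> q < r \<Longrightarrow> w q < w r \<Longrightarrow> w r < w p \<Longrightarrow> w r \<in> L \<Longrightarrow> False"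
    and "\<And>p q r. p < q \<Longrightarrow> q < r \<Longrightarrow> w r < w p \<Longrightarrow> w p < w q \<Longrightarrow> w p \<notin> L \<Longrightarrow> False"
  shows "aligned L w"
  using assms unfolding aligned_def by blast

lemma aligned_id: "aligned L id"
  by (auto simp: aligned_def)

text \<open>A simple reflection \<open>s\<close> preserves the relative order of all values except those it
  exchanges. An exchanged pair inside a forbidden pattern contains the middle value, and
  either the position of the pair or the side of that value rules the pattern out.\<close>
lemma aligned_simple_gen:
  assumes n: "n \<ge> 2" and w: "w \<in> affine_sym n" and d: "left_descent w a"
    and L: "\<And>t. int n dvd t - int a \<Longrightarrow> t \<notin> L \<and> t + 1 \<in> L"
    and L': "\<And>t. int n dvd t - int a \<Longrightarrow> t \<in> L' \<and> t + 1 \<notin> L'"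
    and other: "\<And>t. \<not> int n dvd t - int a \<Longrightarrow> \<not> int n dvd t - int a - 1 \<Longrightarrow> t \<in> L \<longleftrightarrow> t \<in> L'"
  shows "aligned L w \<longleftrightarrow> aligned L' (simple_gen n a \<circ> w)"
proof -
  define v where "v = simple_gen n a \<circ> w"
  have v: "v \<in> affine_sym n" using simple_gen_comp_affine_sym[OF n w] by (simp add: v_def)
  have vd: "\<not> left_descent v a" using left_descent_simple_gen[OF n w] d by (simp add: v_def)
  have vw: "v x = simple_gen n a (w x)" "w x = simple_gen n a (v x)" for x
    using simple_gen_invol[OF n] by (simp_all add: v_def)
  have LL: "simple_gen n a t \<in> L \<longleftrightarrow> t \<in> L'" for t
  proof -
    consider "int n dvd t - int a" | "int n dvd (t - 1) - int a" "\<not> int n dvd t - int a"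
      | "\<not> int n dvd t - int a" "\<not> int n dvd t - int a - 1"
      by (auto simp: algebra_simps)
    then show ?thesis
    proof cases
      case 1
      then show ?thesis using L L' by (simp add: simple_gen_eq)
    next
      case 2
      then show ?thesis using L[of "t - 1"] L'[of "t - 1"] by (simp add: simple_gen_eq algebra_simps)
    next
      case 3
      then show ?thesis using other by (simp add: simple_gen_eq)
    qed
  qed
  have memv: "w x \<in> L \<longleftrightarrow> v x \<in> L'" for x using LL[of "v x"] by (simp add: vw(2)[symmetric])
  have up: "w x < w y \<or> v y = v x + 1 \<and> int n dvd v x - int a" if "v x < v y" for x y
    using simple_gen_mono[OF n that, of a] by (simp add: vw(2)[symmetric])
  have down: "v x < v y \<or> w y = w x + 1 \<and> int n dvd w x - int a" if "w x < w y" for x y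
    using simple_gen_mono[OF n that, of a] by (simp add: vw(1)[symmetric])
  \<comment> \<open>Exchanged values increase from left to right in \<open>v\<close> and decrease in
    \<open>w\<close>.\<close>
  have vpos: "x < y" if "v y = v x + 1" "int n dvd v x - int a" for x y
  proof -
    have "\<not> y < x" using left_descent_iff_at_shift[OF v that(2) that(1) refl] vd by simp
    moreover have "x \<noteq> y" using that(1) by auto
    ultimately show ?thesis by simp
  qed
  have wpos: "y < x" if "w y = w x + 1" "int n dvd w x - int a" for x y
    using left_descent_iff_at_shift[OF w that(2) that(1) refl] d by simp
  have "aligned L' v" if al: "aligned L w"
  proof (rule alignedI)
    fix p q r assume o: "p < q" "q < r" and h: "v q < v r" "v r < v p" "v r \<in> L'"
    have "w q < w r" using up[OF h(1)] L' h(3) by metis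
    moreover have "w r < w p" using up[OF h(2)] vpos[of p r] o by fastforce
    ultimately show False using alignedD(1)[OF al o] memv h(3) by blast
  next
    fix p q r assume o: "p < q" "q < r" and h: "v r < v p" "v p < v q" "v p \<notin> L'"
    have "w r < w p" using up[OF h(1)] vpos[of p r] o by fastforce
    moreover have "w p < w q" using up[OF h(2)] L' h(3) by metis
    ultimately show False using alignedD(2)[OF al o] memv h(3) by blast
  qed
  moreover have "aligned L w" if al: "aligned L' v"
  proof (rule alignedI)
    fix p q r assume o: "p < q" "q < r" and h: "w q < w r" "w r < w p" "w r \<in> L"
    have "v q < v r" using down[OF h(1)] wpos[of r q] o by fastforce
    moreover have "v r < v p" using down[OF h(2)] L h(3) by metis
    ultimately show False using alignedD(1)[OF al o] memv h(3) by blast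
  next
    fix p q r assume o: "p < q" "q < r" and h: "w r < w p" "w p < w q" "w p \<notin> L"
    have "v r < v p" using down[OF h(1)] L h(3) by metis
    moreover have "v p < v q" using down[OF h(2)] wpos[of q p] o by fastforce
    ultimately show False using alignedD(2)[OF al o] memv h(3) by blast
  qed
  ultimately show ?thesis unfolding v_def by blast
qed

text \<open>A value above \<open>t + 1\<close> to the left of \<open>t\<close> would form pattern
  (i) with \<open>t\<close> and \<open>t + 1\<close>. A value above \<open>t\<close> to the right of
  \<open>t\<close>, followed by one below \<open>t\<close>, would form pattern (ii) with
  \<open>t\<close>. So the values are separated at \<open>t\<close>, and
  \<open>affine_sym_cut\<close> applies.\<close>

lemma aligned_ascent_cut:
  assumes n: "n \<ge> 2" and w: "w \<in> affine_sym n" and asc: "\<not> left_descent w a"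
    and al: "aligned L w" and t: "int n dvd t - int a" and L: "t \<notin> L" "t + 1 \<in> L"
  shows "w x \<le> t \<longleftrightarrow> x \<le> t"
proof (rule affine_sym_cut[OF n w])
  fix x y assume xy: "w x \<le> t" "t < w y"
  obtain p q where pq: "w p = t" "w q = t + 1"
    using affine_symD(1)[OF w] by (metis bij_pointE)
  have "p \<noteq> q" using pq by auto
  then have "p < q" using left_descent_iff_at_shift[OF w t pq(2,1)] asc by auto
  show "x < y"
  proof (rule ccontr)
    assume "\<not> x < y"
    moreover have "x \<noteq> y" using xy by auto
    ultimately have yx: "y < x" by simp
    have "\<not> y < p"
    proof
      assume "y < p"
      moreover have "w y \<noteq> t + 1"
        using affine_sym_eq_iff[OF w, of y q] pq \<open>y < p\<close> \<open>p < q\<close> by auto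
      ultimately show False
        using alignedD(1)[OF al \<open>y < p\<close> \<open>p < q\<close>] pq xy(2) L(2) by auto
    qed
    moreover have "p \<noteq> y" using pq xy by auto
    ultimately have "p < y" by simp
    moreover have "w x \<noteq> t"
      using affine_sym_eq_iff[OF w, of x p] pq \<open>p < y\<close> yx by auto
    ultimately show False
      using alignedD(2)[OF al \<open>p < y\<close> yx] pq xy L(1) by auto
  qed
qed

text \<open>For \<open>w\<close> in the affine symmetric group this is membership in the standard parabolic
  subgroup generated by the letters in \<open>J\<close>.\<close>
definition parabolic :: "nat \<Rightarrow> nat set \<Rightarrow> (int \<Rightarrow> int) \<Rightarrow> bool" where
  "parabolic n J w \<longleftrightarrow> (\<forall>t x. nat (t mod int n) \<notin> J \<longrightarrow> (w x \<le> t \<longleftrightarrow> x \<le> t))"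

lemma nat_mod_eq_iff_dvd:
  assumes "n \<ge> 2" "a < n"
  shows "nat (t mod int n) = a \<longleftrightarrow> int n dvd t - int a"
proof -
  have "nat (t mod int n) = a \<longleftrightarrow> t mod int n = int a mod int n"
    using assms by auto
  then show ?thesis by (simp add: mod_eq_dvd_iff)
qed

lemma parabolic_id: "parabolic n J id"
  by (simp add: parabolic_def)

lemma parabolic_all: "n \<ge> 2 \<Longrightarrow> parabolic n {..<n} w"
  by (simp add: parabolic_def nat_less_iff)

lemma parabolic_simple_gen:
  assumes n: "n \<ge> 2" and a: "a \<in> J" "a < n"
  shows "parabolic n J (simple_gen n a \<circ> w) \<longleftrightarrow> parabolic n J w"
proof -
  have "simple_gen n a (w x) \<le> t \<longleftrightarrow> w x \<le> t" if "nat (t mod int n) \<notin> J" for x t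
    using simple_gen_cut nat_mod_eq_iff_dvd[OF n a(2)] a(1) that by metis
  then show ?thesis by (auto simp: parabolic_def)
qed

text \<open>Respecting the cut after \<open>int a\<close> keeps \<open>int a\<close> to the left of
  \<open>int a + 1\<close>.\<close>

lemma parabolic_left_descent:
  assumes n: "n \<ge> 2" and "a < n" "left_descent w a" "parabolic n J w"
  shows "a \<in> J"
proof (rule ccontr)
  assume "a \<notin> J"
  then have cut: "w x \<le> int a \<longleftrightarrow> x \<le> int a" for x
    using assms(2,4) by (simp add: parabolic_def)
  obtain x y where "x < y" "w x = int a + 1" "w y = int a"
    using assms(3) by (auto simp: left_descent_def)
  then show False using cut[of x] cut[of y] by auto
qed

text \<open>The middle value of a pattern in an element of a parabolic subgroup has both of its
  adjacent cuts in \<open>J\<close>, so the sides of other values are irrelevant.\<close>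
lemma aligned_cong:
  assumes n: "n \<ge> 2" and a: "a < n" "a \<notin> J" and P: "parabolic n J w"
    and LL: "\<And>t. \<not> int n dvd t - int a \<Longrightarrow> \<not> int n dvd t - int a - 1 \<Longrightarrow> t \<in> L \<longleftrightarrow> t \<in> L'"
  shows "aligned L w \<longleftrightarrow> aligned L' w"
proof -
  have cut: "w x \<le> t \<longleftrightarrow> x \<le> t" if "int n dvd t - int a" for x t
    using P a nat_mod_eq_iff_dvd[OF n a(1)] that unfolding parabolic_def by metis
  \<comment> \<open>A value above \<open>t\<close> standing left of one below \<open>t\<close>
    violates both the cut after \<open>t\<close> and the cut after \<open>t - 1\<close>.\<close>
  have *: "t \<in> L \<longleftrightarrow> t \<in> L'" if "x < y" "w y < t" "t < w x" for x y t
  proof (rule LL)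
    show "\<not> int n dvd t - int a"
      using cut[of t x] cut[of t y] that by auto
    show "\<not> int n dvd t - int a - 1"
      using cut[of "t - 1" x] cut[of "t - 1" y] that by (auto simp: algebra_simps)
  qed
  have **: "w r \<in> L \<longleftrightarrow> w r \<in> L'" if "p < q" "w q < w r" "w r < w p" for p q r
    using * that by blast
  have ***: "w p \<in> L \<longleftrightarrow> w p \<in> L'" if "q < r" "w r < w p" "w p < w q" for p q r
    using * that by blast
  show ?thesis
    unfolding aligned_def using ** *** by meson
qed

subsection \<open>Greedy sorting\<close>

text \<open>Indexing by integers avoids a special case for the adjacent letters \<open>n - 1\<close>
  and \<open>0\<close>.\<close>

definition next_occ :: "nat \<Rightarrow> nat list \<Rightarrow> nat \<Rightarrow> int \<Rightarrow> nat" where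
  "next_occ n us p x = (LEAST d. inf_word us (p + d) = nat (x mod int n))"

text \<open>This is \<open>L_set\<close> of the Coxeter element spelled by the \<open>n\<close> letters from position \<open>p\<close> on.\<close>
definition up_set :: "nat \<Rightarrow> nat list \<Rightarrow> nat \<Rightarrow> int set" where
  "up_set n us p = {j. next_occ n us p (j - 1) < next_occ n us p j}"

definition reduced_from :: "nat \<Rightarrow> nat list \<Rightarrow> nat \<Rightarrow> (int \<Rightarrow> int) \<Rightarrow> nat list \<Rightarrow> bool" where
  "reduced_from n us p w ps \<longleftrightarrow> reduced_positions n us w ps \<and> (\<forall>q\<in>set ps. p \<le> q)"

text \<open>The start \<open>p\<close> is a parameter so that the word can be consumed letter by
  letter; \<open>p = 0\<close> recovers \<open>sorting_positions\<close>.\<close>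

definition sorting_from :: "nat \<Rightarrow> nat list \<Rightarrow> nat \<Rightarrow> (int \<Rightarrow> int) \<Rightarrow> nat list \<Rightarrow> bool" where
  "sorting_from n us p w ps \<longleftrightarrow> reduced_from n us p w ps \<and>
     (\<forall>qs. reduced_from n us p w qs \<longrightarrow> ps = qs \<or> (ps, qs) \<in> lexord less_than)"

text \<open>\<open>J\<close> is the set of letters that have not been skipped before position \<open>p\<close>.\<close>
definition nested_from :: "nat \<Rightarrow> nat list \<Rightarrow> nat \<Rightarrow> nat set \<Rightarrow> nat list \<Rightarrow> bool" where
  "nested_from n us p J ps \<longleftrightarrow>
     (\<forall>q\<in>set ps. inf_word us q \<in> J \<and> (p + n \<le> q \<longrightarrow> q - n \<in> set ps))"

section \<open>Occurrences of letters in the infinite word\<close>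

context
  fixes n :: nat and us :: "nat list"
  assumes n: "n \<ge> 2" and dist: "distinct us" and set_us: "set us = {..<n}"
begin

lemma length_us: "length us = n"
  using distinct_card[OF dist] set_us by simp

lemma inf_word_less: "inf_word us p < n"
proof -
  have "p mod length us < length us" using length_us n by simp
  then show ?thesis
    unfolding inf_word_def using set_us nth_mem by blast
qed

lemma inf_word_eq_iff: "inf_word us p = inf_word us q \<longleftrightarrow> p mod n = q mod n"
  using n length_us dist by (simp add: inf_word_def nth_eq_iff_index_eq)

lemma ex_inf_word:
  assumes "a < n"
  shows "\<exists>d<n. inf_word us (p + d) = a"
proof -
  obtain k where k: "k < n" "us ! k = a"
    using assms set_us length_us by (metis in_set_conv_nth lessThan_iff)
  \<comment> \<open>The distance from the residue of \<open>p\<close> forward to \<open>k\<close>;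
    adding \<open>n\<close> keeps the subtraction within the naturals.\<close>
  define d where "d = (k + (n - p mod n)) mod n"
  have "(p + d) mod n = (p mod n + (k + (n - p mod n))) mod n"
    by (simp add: d_def mod_simps)
  also have "p mod n + (k + (n - p mod n)) = k + n"
    using mod_less_divisor[of n p] n by linarith
  finally have "(p + d) mod n = k" using k by simp
  then have "inf_word us (p + d) = a" using k length_us by (simp add: inf_word_def)
  moreover have "d < n" using n by (simp add: d_def)
  ultimately show ?thesis by blast
qed

lemma next_occ_props:
  "inf_word us (p + next_occ n us p x) = nat (x mod int n)" "next_occ n us p x < n"
proof -
  have "nat (x mod int n) < n" using n by (simp add: nat_less_iff)
  then obtain d where d: "d < n" "inf_word us (p + d) = nat (x mod int n)"
    using ex_inf_word by blast
  show "inf_word us (p + next_occ n us p x) = nat (x mod int n)"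
    unfolding next_occ_def using d(2) by (rule LeastI)
  have "next_occ n us p x \<le> d"
    unfolding next_occ_def using d(2) by (rule Least_le)
  then show "next_occ n us p x < n" using d(1) by simp
qed

lemma next_occ_eq:
  assumes "inf_word us (p + d) = nat (x mod int n)" "d < n"
  shows "next_occ n us p x = d"
proof -
  have "(p + next_occ n us p x) mod n = (p + d) mod n"
    using assms(1) next_occ_props(1)[of p x] inf_word_eq_iff by metis
  then have "[next_occ n us p x = d] (mod n)"
    using cong_add_lcancel_nat[of p "next_occ n us p x" d n] by (simp add: cong_def)
  then show ?thesis
    using assms(2) next_occ_props(2)[of p x] cong_less_modulus_unique_nat by blast
qed

lemma inf_word_eq_dvd_iff:
  "nat (x mod int n) = inf_word us p \<longleftrightarrow> int n dvd x - int (inf_word us p)"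
  using nat_mod_eq_iff_dvd[OF n inf_word_less] .

lemma next_occ_zero_iff:
  "next_occ n us p x = 0 \<longleftrightarrow> int n dvd x - int (inf_word us p)"
  using next_occ_eq[of p 0 x] next_occ_props(1)[of p x] n inf_word_eq_dvd_iff[of x p] by auto

text \<open>Passing position \<open>p\<close> makes its letter the last of the next \<open>n\<close>
  and brings all others one step nearer.\<close>

lemma next_occ_Suc:
  "next_occ n us (Suc p) x =
    (if int n dvd x - int (inf_word us p) then n - 1 else next_occ n us p x - 1)"
proof (cases "int n dvd x - int (inf_word us p)")
  case True
  have "inf_word us (p + n) = inf_word us p" by (simp add: inf_word_eq_iff)
  then have "inf_word us (Suc p + (n - 1)) = nat (x mod int n)"
    using True inf_word_eq_dvd_iff[of x p] n by simp
  then show ?thesis using next_occ_eq[of "Suc p" "n - 1"] True n by simp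
next
  case False
  then have "next_occ n us p x \<noteq> 0" by (simp add: next_occ_zero_iff)
  then obtain m where m: "next_occ n us p x = Suc m" using not0_implies_Suc by blast
  then have "next_occ n us (Suc p) x = m"
    using next_occ_props[of p x] by (intro next_occ_eq) simp_all
  then show ?thesis using m False by simp
qed

lemma up_set_current:
  assumes "int n dvd t - int (inf_word us p)"
  shows "t \<notin> up_set n us p \<and> t + 1 \<in> up_set n us p"
proof -
  have "next_occ n us p t = 0" using assms by (simp add: next_occ_zero_iff)
  moreover have "next_occ n us p (t + 1) \<noteq> 0"
    using not_dvd_consecutive(1)[OF n assms] by (simp add: next_occ_zero_iff algebra_simps)
  ultimately show ?thesis by (simp add: up_set_def)
qed

text \<open>The letter just passed now comes after both of its neighbours.\<close>

lemma up_set_Suc_current: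
  assumes "int n dvd t - int (inf_word us p)"
  shows "t \<in> up_set n us (Suc p) \<and> t + 1 \<notin> up_set n us (Suc p)"
proof -
  have m: "next_occ n us (Suc p) t = n - 1" using assms by (simp add: next_occ_Suc)
  have "\<not> int n dvd t - 1 - int (inf_word us p)"
    using not_dvd_consecutive(2)[OF n assms] by (simp add: algebra_simps)
  then have "next_occ n us (Suc p) (t - 1) < n - 1"
    using next_occ_props(2)[of p "t - 1"] next_occ_zero_iff[of p "t - 1"]
    by (simp add: next_occ_Suc)
  then show ?thesis
    using m next_occ_props(2)[of "Suc p" "t + 1"] by (simp add: up_set_def)
qed

text \<open>Neither letter \<open>t - 1\<close> nor letter \<open>t\<close> is the one passed, so
  both come one step nearer and their order persists.\<close>

lemma up_set_Suc_other:
  assumes "\<not> int n dvd t - int (inf_word us p)" "\<not> int n dvd t - int (inf_word us p) - 1"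
  shows "t \<in> up_set n us p \<longleftrightarrow> t \<in> up_set n us (Suc p)"
proof -
  have "\<not> int n dvd t - 1 - int (inf_word us p)"
    using assms(2) by (simp add: algebra_simps)
  then show ?thesis
    using assms(1) next_occ_zero_iff[of p t] next_occ_zero_iff[of p "t - 1"]
    by (auto simp: up_set_def next_occ_Suc)
qed

section \<open>Greedy choice of the sorting positions\<close>

lemma ex_positions:
  assumes "set vs \<subseteq> {..<n}"
  shows "\<exists>qs. sorted_wrt (<) qs \<and> (\<forall>q\<in>set qs. p \<le> q) \<and> map (inf_word us) qs = vs"
  using assms
proof (induction vs arbitrary: p)
  case (Cons v vs)
  obtain d where d: "inf_word us (p + d) = v" using ex_inf_word[of v p] Cons.prems by auto
  obtain qs where qs: "sorted_wrt (<) qs" "\<forall>q\<in>set qs. Suc (p + d) \<le> q" "map (inf_word us) qs = vs"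
    using Cons.IH[of "Suc (p + d)"] Cons.prems by auto
  then show ?case
    using d by (intro exI[of _ "(p + d) # qs"]) (auto simp: Suc_le_eq intro: less_imp_le dest: add_lessD1)
qed simp

lemma ex_reduced_from:
  assumes w: "w \<in> affine_sym n"
  shows "\<exists>qs. reduced_from n us p w qs"
proof -
  obtain vs where vs: "is_word_of n w vs" "length vs = card (inversions n w)"
    using ex_word_card_inversions[OF n w] by blast
  then have "set vs \<subseteq> {..<n}" by (simp add: is_word_of_def)
  from ex_positions[OF this, of p] vs show ?thesis
    by (auto simp: reduced_from_def reduced_positions_def reduced_word_iff_card_inversions[OF n w])
qed

lemma reduced_from_Cons:
  assumes w: "w \<in> affine_sym n"
  shows "reduced_from n us p w (p # qs) \<longleftrightarrow> left_descent w (inf_word us p) \<and>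
    reduced_from n us (Suc p) (simple_gen n (inf_word us p) \<circ> w) qs"
  using reduced_word_Cons[OF n w inf_word_less]
  by (auto simp: reduced_from_def reduced_positions_def Suc_le_eq intro: less_imp_le)

lemma reduced_from_cases:
  assumes "reduced_from n us p w ps"
  shows "(\<exists>qs. ps = p # qs) \<or> reduced_from n us (Suc p) w ps"
proof (cases ps)
  case (Cons x xs)
  then have "x = p \<or> Suc p \<le> x" "\<forall>q\<in>set xs. x < q"
    using assms by (auto simp: reduced_from_def reduced_positions_def Suc_le_eq order_le_less)
  then show ?thesis
    using assms Cons by (auto simp: reduced_from_def Suc_le_eq)
qed (use assms in \<open>simp add: reduced_from_def\<close>)

lemma reduced_from_Suc: "reduced_from n us (Suc p) w ps \<Longrightarrow> reduced_from n us p w ps"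
  by (auto simp: reduced_from_def)

lemma reduced_from_nonempty:
  assumes w: "w \<in> affine_sym n" and "left_descent w a"
  shows "\<not> reduced_from n us p w []"
  using card_inversions_descent[OF n assms] reduced_word_iff_card_inversions[OF n w, of "[]"]
  by (auto simp: reduced_from_def reduced_positions_def)

text \<open>No reduced word starts with an ascent, so starting at \<open>p\<close> or at
  \<open>Suc p\<close> leaves the same candidates.\<close>

lemma sorting_from_ascent:
  assumes w: "w \<in> affine_sym n" and "\<not> left_descent w (inf_word us p)"
  shows "sorting_from n us p w ps \<longleftrightarrow> sorting_from n us (Suc p) w ps"
proof -
  have "reduced_from n us p w qs \<longleftrightarrow> reduced_from n us (Suc p) w qs" for qs
    using reduced_from_cases reduced_from_Suc reduced_from_Cons[OF w] assms(2) by blast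
  then show ?thesis by (simp add: sorting_from_def)
qed

lemma sorting_from_descent:
  assumes w: "w \<in> affine_sym n" and d: "left_descent w (inf_word us p)"
  shows "sorting_from n us p w ps \<longleftrightarrow>
    (\<exists>qs. ps = p # qs \<and> sorting_from n us (Suc p) (simple_gen n (inf_word us p) \<circ> w) qs)"
    (is "_ \<longleftrightarrow> (\<exists>qs. _ \<and> sorting_from n us (Suc p) ?v qs)")
proof
  have v: "?v \<in> affine_sym n" using simple_gen_comp_affine_sym[OF n w] .
  have R: "reduced_from n us p w (p # qs) \<longleftrightarrow> reduced_from n us (Suc p) ?v qs" for qs
    using reduced_from_Cons[OF w] d by blast
  {
    assume s: "sorting_from n us p w ps"
    \<comment> \<open>A competitor beginning with \<open>p\<close> exists, so the lexicographically
      first list cannot begin later.\<close>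
    obtain qs0 where "reduced_from n us (Suc p) ?v qs0" using ex_reduced_from[OF v] by blast
    then have "ps = p # qs0 \<or> (ps, p # qs0) \<in> lexord less_than"
      using s R by (simp add: sorting_from_def)
    moreover obtain x xs where ps: "ps = x # xs"
      using s reduced_from_nonempty[OF w d] by (cases ps) (auto simp: sorting_from_def)
    moreover have "p \<le> x"
      using s ps by (simp add: sorting_from_def reduced_from_def)
    ultimately have x: "x = p" by auto
    have "sorting_from n us (Suc p) ?v xs"
      unfolding sorting_from_def
    proof (intro conjI allI impI)
      show "reduced_from n us (Suc p) ?v xs"
        using s ps x R by (simp add: sorting_from_def)
      fix qs assume "reduced_from n us (Suc p) ?v qs"
      then have "reduced_from n us p w (p # qs)" using R by simp
      then have "ps = p # qs \<or> (ps, p # qs) \<in> lexord less_than"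
        using s unfolding sorting_from_def by blast
      then show "xs = qs \<or> (xs, qs) \<in> lexord less_than"
        using ps x by simp
    qed
    then show "\<exists>qs. ps = p # qs \<and> sorting_from n us (Suc p) ?v qs" using ps x by blast
  next
    assume "\<exists>qs. ps = p # qs \<and> sorting_from n us (Suc p) ?v qs"
    then obtain qs where qs: "ps = p # qs" "sorting_from n us (Suc p) ?v qs" by blast
    show "sorting_from n us p w ps"
      unfolding sorting_from_def
    proof (intro conjI allI impI)
      show "reduced_from n us p w ps" using qs R by (simp add: sorting_from_def)
      fix rs assume r: "reduced_from n us p w rs"
      then obtain x xs where rs: "rs = x # xs"
        using reduced_from_nonempty[OF w d] by (cases rs) auto
      then have "p \<le> x" using r by (simp add: reduced_from_def)
      show "ps = rs \<or> (ps, rs) \<in> lexord less_than"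
      proof (cases "x = p")
        case True
        then have "reduced_from n us (Suc p) ?v xs" using r rs R by simp
        then have "qs = xs \<or> (qs, xs) \<in> lexord less_than"
          using qs(2) unfolding sorting_from_def by blast
        then show ?thesis using qs(1) rs True by simp
      qed (use \<open>p \<le> x\<close> rs qs(1) in simp)
    qed
  }
qed

section \<open>Nestedness when a letter is taken or skipped\<close>

lemma nested_from_Cons:
  assumes "\<forall>q\<in>set qs. Suc p \<le> q"
  shows "nested_from n us p J (p # qs) \<longleftrightarrow> inf_word us p \<in> J \<and> nested_from n us (Suc p) J qs"
proof
  assume h: "nested_from n us p J (p # qs)"
  have "q - n \<in> set qs" if "q \<in> set qs" "Suc p + n \<le> q" for q
  proof -
    have "q - n \<in> set (p # qs)" using h that by (simp add: nested_from_def)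
    moreover have "q - n \<noteq> p" using that by simp
    ultimately show ?thesis by simp
  qed
  then show "inf_word us p \<in> J \<and> nested_from n us (Suc p) J qs"
    using h by (simp add: nested_from_def)
next
  assume h: "inf_word us p \<in> J \<and> nested_from n us (Suc p) J qs"
  \<comment> \<open>Only \<open>q = p + n\<close> asks for \<open>p\<close>, which is the head;
    larger \<open>q\<close> are covered by the condition from \<open>Suc p\<close> on.\<close>
  have "q - n \<in> set (p # qs)" if "q \<in> set qs" "p + n \<le> q" for q
    using h that by (cases "q = p + n") (auto simp: nested_from_def)
  then show "nested_from n us p J (p # qs)"
    using h n by (simp add: nested_from_def)
qed

text \<open>Omitting \<open>p\<close> excludes \<open>p + n\<close>, then \<open>p + 2 * n\<close>,
  and so on: exactly the later occurrences of its letter. Hence the letter leaves \<open>J\<close>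
  for good.\<close>

lemma nested_from_skip:
  assumes "\<forall>q\<in>set ps. Suc p \<le> q"
  shows "nested_from n us p J ps \<longleftrightarrow> nested_from n us (Suc p) (J - {inf_word us p}) ps"
proof
  assume h: "nested_from n us p J ps"
  have no: "p + k * n \<notin> set ps" for k
  proof (induction k)
    case 0
    then show ?case using assms by force
  next
    case (Suc k)
    then show ?case using h by (fastforce simp: nested_from_def)
  qed
  have "inf_word us q \<noteq> inf_word us p" if "q \<in> set ps" for q
  proof
    assume "inf_word us q = inf_word us p"
    then have "p mod n = q mod n" by (simp add: inf_word_eq_iff)
    moreover have "p \<le> q" using assms that by force
    ultimately obtain k where "q = p + n * k" using mod_eq_nat1E[of q n p] by metis
    then show False using no[of k] that by (simp add: mult.commute)
  qed
  then show "nested_from n us (Suc p) (J - {inf_word us p}) ps"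
    using h by (simp add: nested_from_def)
next
  assume h: "nested_from n us (Suc p) (J - {inf_word us p}) ps"
  have "q - n \<in> set ps" if "q \<in> set ps" "p + n \<le> q" for q
  proof -
    have "inf_word us q \<noteq> inf_word us p" using h that by (simp add: nested_from_def)
    then have "q \<noteq> p + n" by (auto simp: inf_word_eq_iff)
    then show ?thesis using h that by (simp add: nested_from_def)
  qed
  then show "nested_from n us p J ps" using h by (simp add: nested_from_def)
qed

section \<open>Sortability and avoidance along the greedy reading\<close>

lemma sorting_from_ge: "sorting_from n us p w ps \<Longrightarrow> \<forall>q\<in>set ps. p \<le> q"
  by (simp add: sorting_from_def reduced_from_def)

lemma sorting_from_id: "sorting_from n us p id ps \<longleftrightarrow> ps = []"
  using reduced_word_iff_card_inversions[OF n id_affine_sym]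
  by (auto simp: sorting_from_def reduced_from_def reduced_positions_def inversions_id is_word_of_def)

definition sortable_from :: "nat \<Rightarrow> nat set \<Rightarrow> (int \<Rightarrow> int) \<Rightarrow> bool" where
  "sortable_from p J w \<longleftrightarrow> (\<exists>ps. sorting_from n us p w ps \<and> nested_from n us p J ps)"

lemma sortable_from_descent:
  assumes w: "w \<in> affine_sym n" and d: "left_descent w (inf_word us p)"
  shows "sortable_from p J w \<longleftrightarrow> inf_word us p \<in> J \<and>
    sortable_from (Suc p) J (simple_gen n (inf_word us p) \<circ> w)"
proof -
  have "nested_from n us p J (p # qs) \<longleftrightarrow> inf_word us p \<in> J \<and> nested_from n us (Suc p) J qs"
    if "sorting_from n us (Suc p) (simple_gen n (inf_word us p) \<circ> w) qs" for qs
    using nested_from_Cons[OF sorting_from_ge[OF that]] .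
  then show ?thesis
    unfolding sortable_from_def sorting_from_descent[OF assms] by blast
qed

lemma sortable_from_ascent:
  assumes w: "w \<in> affine_sym n" and d: "\<not> left_descent w (inf_word us p)"
  shows "sortable_from p J w \<longleftrightarrow> sortable_from (Suc p) (J - {inf_word us p}) w"
proof -
  have "nested_from n us p J ps \<longleftrightarrow> nested_from n us (Suc p) (J - {inf_word us p}) ps"
    if "sorting_from n us (Suc p) w ps" for ps
    using nested_from_skip[OF sorting_from_ge[OF that]] .
  then show ?thesis
    unfolding sortable_from_def sorting_from_ascent[OF assms] by blast
qed

text \<open>Avoidance forces the cut at the skipped letter, which removes the letter from
  \<open>J\<close>. Once that cut holds, the old and new sides agree at every possible middle value
  of a pattern.\<close>

lemma aligned_ascent:
  assumes w: "w \<in> affine_sym n" and asc: "\<not> left_descent w (inf_word us p)"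
  shows "parabolic n J w \<and> aligned (up_set n us p) w \<longleftrightarrow>
    parabolic n (J - {inf_word us p}) w \<and> aligned (up_set n us (Suc p)) w"
proof -
  let ?a = "inf_word us p"
  have "aligned (up_set n us p) w \<longleftrightarrow> aligned (up_set n us (Suc p)) w"
    if "parabolic n (J - {?a}) w"
    using aligned_cong[OF n inf_word_less _ that] up_set_Suc_other by blast
  moreover have "parabolic n (J - {?a}) w" if "parabolic n J w" "aligned (up_set n us p) w"
    unfolding parabolic_def
  proof (intro allI impI)
    fix t x assume t: "nat (t mod int n) \<notin> J - {?a}"
    show "w x \<le> t \<longleftrightarrow> x \<le> t"
    proof (cases "nat (t mod int n) = ?a")
      case True
      then have "int n dvd t - int ?a" by (simp add: inf_word_eq_dvd_iff)
      then show ?thesis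
        using aligned_ascent_cut[OF n w asc that(2)] up_set_current by blast
    next
      case False
      then show ?thesis using t that(1) by (simp add: parabolic_def)
    qed
  qed
  moreover have "parabolic n J w" if "parabolic n (J - {?a}) w"
    using that by (simp add: parabolic_def)
  ultimately show ?thesis by blast
qed

text \<open>A descent shortens \<open>w\<close>, so induction on length handles it. Ascents leave
  \<open>w\<close> unchanged and need an inner induction.\<close>

lemma sortable_from_iff:
  assumes "w \<in> affine_sym n"
  shows "sortable_from p J w \<longleftrightarrow> parabolic n J w \<and> aligned (up_set n us p) w"
  using assms
proof (induction "card (inversions n w)" arbitrary: w p J rule: less_induct)
  case less
  note w = less.prems
  have descent: "sortable_from p J w \<longleftrightarrow> parabolic n J w \<and> aligned (up_set n us p) w"
    if d: "left_descent w (inf_word us p)" for p J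
  proof -
    let ?a = "inf_word us p"
    let ?v = "simple_gen n ?a \<circ> w"
    have "sortable_from (Suc p) J ?v \<longleftrightarrow> parabolic n J ?v \<and> aligned (up_set n us (Suc p)) ?v"
      using less.hyps[of ?v] card_inversions_descent[OF n w d] simple_gen_comp_affine_sym[OF n w]
      by simp
    moreover have "aligned (up_set n us p) w \<longleftrightarrow> aligned (up_set n us (Suc p)) ?v"
      by (rule aligned_simple_gen[OF n w d up_set_current up_set_Suc_current up_set_Suc_other])
    moreover have "parabolic n J ?v \<longleftrightarrow> parabolic n J w" if "?a \<in> J"
      using parabolic_simple_gen[OF n that inf_word_less] .
    moreover have "?a \<in> J" if "parabolic n J w"
      using parabolic_left_descent[OF n inf_word_less d that] .
    moreover note sortable_from_descent[OF w d, of J]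
    ultimately show ?thesis by argo
  qed
  \<comment> \<open>The inner induction is on the distance \<open>d\<close> to a position carrying a
    descent of \<open>w\<close>.\<close>
  have main: "sortable_from p J w \<longleftrightarrow> parabolic n J w \<and> aligned (up_set n us p) w"
    if "left_descent w (inf_word us (p + d))" for d p J
    using that
  proof (induction d arbitrary: p J)
    case 0
    then show ?case using descent by simp
  next
    case (Suc d)
    show ?case
    proof (cases "left_descent w (inf_word us p)")
      case False
      then show ?thesis
        using sortable_from_ascent[OF w False] aligned_ascent[OF w False] Suc by simp
    qed (rule descent)
  qed
  show ?case
  proof (cases "w = id")
    case True
    then show ?thesis
      by (simp add: sortable_from_def sorting_from_id nested_from_def parabolic_id aligned_id)
  next
    case False
    then obtain a where "a < n" "left_descent w a" using ex_left_descent[OF n w] by blast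
    then show ?thesis using main[of p] ex_inf_word[of a p] by metis
  qed
qed

text \<open>Each copy contains every letter once, so equal letters in consecutive copies lie exactly
  \<open>n\<close> positions apart.\<close>

lemma nested_from_iff_copy_letters:
  "nested_from n us 0 {..<n} ps \<longleftrightarrow>
    (\<forall>r. copy_letters us ps (Suc r) \<subseteq> copy_letters us ps r)"
proof
  assume h: "nested_from n us 0 {..<n} ps"
  show "\<forall>r. copy_letters us ps (Suc r) \<subseteq> copy_letters us ps r"
  proof (intro allI subsetI)
    fix r x assume "x \<in> copy_letters us ps (Suc r)"
    then obtain q where q: "q \<in> set ps" "q div n = Suc r" "x = inf_word us q"
      by (auto simp: copy_letters_def length_us)
    then have "n \<le> q" by (metis div_less not_le nat.distinct(1))
    then have "q - n \<in> set ps" "(q - n) div n = r" "inf_word us (q - n) = x"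
      using h q n by (auto simp: nested_from_def le_div_geq inf_word_eq_iff le_mod_geq)
    then show "x \<in> copy_letters us ps r" by (auto simp: copy_letters_def length_us)
  qed
next
  assume h: "\<forall>r. copy_letters us ps (Suc r) \<subseteq> copy_letters us ps r"
  have "q - n \<in> set ps" if q: "q \<in> set ps" "n \<le> q" for q
  proof -
    have "q div n = Suc ((q - n) div n)" using q n by (simp add: le_div_geq)
    then have "inf_word us q \<in> copy_letters us ps ((q - n) div n)"
      using h q(1) by (fastforce simp: copy_letters_def length_us)
    then obtain q' where q': "q' \<in> set ps" "q' div n = (q - n) div n" "inf_word us q' = inf_word us q"
      by (auto simp: copy_letters_def length_us)
    then have "q' mod n = (q - n) mod n" using q by (simp add: inf_word_eq_iff le_mod_geq)
    then have "q' = q - n" using q'(2) by (metis div_mult_mod_eq)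
    then show ?thesis using q'(1) by simp
  qed
  then show "nested_from n us 0 {..<n} ps"
    using inf_word_less by (simp add: nested_from_def)
qed

lemma sortable_iff_aligned:
  assumes "w \<in> affine_sym n"
  shows "sortable n us w \<longleftrightarrow> aligned (up_set n us 0) w"
proof -
  have "sorting_positions n us w ps \<longleftrightarrow> sorting_from n us 0 w ps" for ps
    by (simp add: sorting_positions_def sorting_from_def reduced_from_def)
  then have "sortable n us w \<longleftrightarrow> sortable_from 0 {..<n} w"
    by (simp add: sortable_def sortable_from_def nested_from_iff_copy_letters)
  then show ?thesis using sortable_from_iff[OF assms] parabolic_all[OF n] by simp
qed

end

subsection \<open>Coxeter elements\<close>

lemma word_prod_cut:
  assumes "\<forall>a\<in>set vs. \<not> int n dvd t - int a"
  shows "word_prod n vs x \<le> t \<longleftrightarrow> x \<le> t"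
  using assms by (induction vs) (auto simp: word_prod_Cons simple_gen_cut)

lemma split_list_two:
  assumes "i < k" "k < length xs"
  shows "\<exists>A B C. xs = A @ xs ! i # B @ xs ! k # C"
proof -
  have "xs = take k xs @ xs ! k # drop (Suc k) xs"
    using assms by (simp add: id_take_nth_drop)
  moreover have "take k xs = take i xs @ xs ! i # drop (Suc i) (take k xs)"
    using assms id_take_nth_drop[of i "take k xs"] by (simp add: min_def)
  ultimately show ?thesis by (metis append.assoc append_Cons)
qed

context
  fixes n :: nat and us :: "nat list"
  assumes n: "n \<ge> 2" and dist: "distinct us" and set_us: "set us = {..<n}"
begin

text \<open>Letters act from right to left, so \<open>j\<close> first moves under the later of the
  letters \<open>j - 1\<close> and \<open>j\<close>: down or up, respectively. That letter does not
  occur again, so the value never crosses back.\<close>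

lemma up_set_word_prod:
  "j \<in> up_set n us 0 \<Longrightarrow> j < word_prod n us j"
  "j \<notin> up_set n us 0 \<Longrightarrow> word_prod n us j < j"
proof -
  define a where "a = nat ((j - 1) mod int n)"
  define b where "b = nat (j mod int n)"
  have ab: "a < n" "b < n" using n by (simp_all add: a_def b_def nat_less_iff)
  have da: "int n dvd j - 1 - int a'" if "a' = a" for a'
    using nat_mod_eq_iff_dvd[OF n ab(1), of "j - 1"] a_def that by simp
  have db: "int n dvd j - int b'" if "b' = b" for b'
    using nat_mod_eq_iff_dvd[OF n ab(2), of j] b_def that by simp
  have na: "\<not> int n dvd j - 1 - int a'" if "a' \<noteq> a" "a' < n" for a'
    using nat_mod_eq_iff_dvd[OF n that(2), of "j - 1"] a_def that(1) by simp
  have nb: "\<not> int n dvd j - int b'" if "b' \<noteq> b" "b' < n" for b'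
    using nat_mod_eq_iff_dvd[OF n that(2), of j] b_def that(1) by simp
  have neq: "a \<noteq> b"
    using da[OF refl] db[OF refl] not_dvd_consecutive(1)[OF n, of "j - 1 - int a"] by auto
  have len: "length us = n" using length_us[OF n dist set_us] .
  let ?i = "next_occ n us 0 (j - 1)" and ?k = "next_occ n us 0 j"
  have i: "us ! ?i = a" "?i < length us"
    using next_occ_props[OF n dist set_us, of 0 "j - 1"] len by (simp_all add: inf_word_def a_def)
  have k: "us ! ?k = b" "?k < length us"
    using next_occ_props[OF n dist set_us, of 0 j] len by (simp_all add: inf_word_def b_def)
  have cutb: "word_prod n vs x \<le> j \<longleftrightarrow> x \<le> j" if "b \<notin> set vs" "set vs \<subseteq> {..<n}" for vs x
    by (rule word_prod_cut) (metis nb that lessThan_iff subset_iff)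
  have cuta: "word_prod n vs x \<le> j - 1 \<longleftrightarrow> x \<le> j - 1" if "a \<notin> set vs" "set vs \<subseteq> {..<n}" for vs x
    by (rule word_prod_cut) (metis na that lessThan_iff subset_iff)
  have fix_j: "word_prod n vs j = j" if "a \<notin> set vs" "b \<notin> set vs" "set vs \<subseteq> {..<n}" for vs
    using cuta[OF that(1,3), of j] cutb[OF that(2,3), of j] by simp
  {
    assume "j \<in> up_set n us 0"
    then have "?i < ?k" by (simp add: up_set_def)
    then obtain A B C where us: "us = A @ a # B @ b # C"
      using split_list_two[of ?i ?k us] i k by metis
    have C: "word_prod n C j = j"
      by (rule fix_j) (use us dist set_us in auto)
    have "simple_gen n b j = j + 1" using db by (simp add: simple_gen_eq)
    then have "word_prod n us j = word_prod n (A @ a # B) (j + 1)"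
      using C by (simp add: us word_prod_append word_prod_Cons)
    moreover have "\<not> word_prod n (A @ a # B) (j + 1) \<le> j"
      using cutb[of "A @ a # B" "j + 1"] us dist set_us neq by auto
    ultimately show "j < word_prod n us j" by simp
  next
    assume "j \<notin> up_set n us 0"
    moreover have "?i \<noteq> ?k" using i k neq by metis
    ultimately have "?k < ?i" by (simp add: up_set_def)
    then obtain A B C where us: "us = A @ b # B @ a # C"
      using split_list_two[of ?k ?i us] i k by metis
    have C: "word_prod n C j = j"
      by (rule fix_j) (use us dist set_us in auto)
    have "simple_gen n a j = j - 1"
      using da[OF refl] nb[OF neq ab(1)] by (simp add: simple_gen_eq algebra_simps)
    then have "word_prod n us j = word_prod n (A @ b # B) (j - 1)"
      using C by (simp add: us word_prod_append word_prod_Cons)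
    moreover have "word_prod n (A @ b # B) (j - 1) \<le> j - 1"
      using cuta[of "A @ b # B" "j - 1"] us dist set_us neq by auto
    ultimately show "word_prod n us j < j" by simp
  }
qed

text \<open>The single letter \<open>i\<close> lifts a value from \<open>int i\<close> to
  \<open>int i + 1\<close>, and no other letter crosses this cut. So a Coxeter element lies in no
  proper standard parabolic subgroup.\<close>

lemma word_prod_breaks_cuts:
  assumes "i < n"
  shows "\<exists>x. \<not> (word_prod n us x \<le> int i \<longleftrightarrow> x \<le> int i)"
proof -
  obtain A B where us: "us = A @ i # B" using split_list[of i us] assms set_us by blast
  have cut: "word_prod n vs x \<le> int i \<longleftrightarrow> x \<le> int i" if "i \<notin> set vs" "set vs \<subseteq> {..<n}" for vs x
  proof (rule word_prod_cut, intro ballI)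
    fix b assume "b \<in> set vs"
    then have "b < n" "b \<noteq> i" using that by auto
    then show "\<not> int n dvd int i - int b"
      using assms nat_mod_eq_iff_dvd[OF n, of b "int i"] by simp
  qed
  obtain x where x: "word_prod n B x = int i"
    using affine_symD(1)[OF word_prod_affine_sym[OF n]] by (metis bij_pointE)
  then have "x \<le> int i" using cut[of B x] us dist set_us by auto
  moreover have "word_prod n us x = word_prod n A (int i + 1)"
    using x by (simp add: us word_prod_append word_prod_Cons simple_gen_eq)
  moreover have "\<not> word_prod n A (int i + 1) \<le> int i"
    using cut[of A "int i + 1"] us dist set_us by auto
  ultimately show ?thesis by metis
qed

end

text \<open>A missing letter would leave its cut intact, so all \<open>n\<close> letters occur;
  minimality against the defining word of length \<open>n\<close> excludes repetitions.\<close>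

lemma reduced_word_coxeter:
  assumes n: "n \<ge> 2" and c: "coxeter_element n c" and r: "reduced_word n c us"
  shows "distinct us" "set us = {..<n}" "word_prod n us = c"
proof -
  obtain vs where vs: "distinct vs" "set vs = {..<n}" "c = word_prod n vs"
    using c by (auto simp: coxeter_element_def)
  have us: "set us \<subseteq> {..<n}" "word_prod n us = c"
    using r by (auto simp: reduced_word_def is_word_of_def)
  have "i \<in> set us" if i: "i < n" for i
  proof (rule ccontr)
    assume "i \<notin> set us"
    then have "\<not> int n dvd int i - int b" if "b \<in> set us" for b
      using that us(1) i nat_mod_eq_iff_dvd[OF n, of b "int i"] by auto
    then have "c x \<le> int i \<longleftrightarrow> x \<le> int i" for x
      using word_prod_cut[of us n "int i" x] us(2) by simp
    then show False using word_prod_breaks_cuts[OF n vs(1,2) i] vs(3) by auto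
  qed
  then show set_us: "set us = {..<n}" using us(1) by auto
  have "length us \<le> length vs"
    using r vs by (simp add: reduced_word_def is_word_of_def)
  also have "\<dots> = card (set us)" using distinct_card[OF vs(1)] vs(2) set_us by simp
  finally show "distinct us" using card_length[of us] by (intro card_distinct) simp
  show "word_prod n us = c" by (rule us(2))
qed

theorem theoremA:
  fixes n :: nat and c w :: "int \<Rightarrow> int" and us :: "nat list"
  assumes "n \<ge> 2"
    and "coxeter_element n c"
    and "reduced_word n c us"
    and "w \<in> affine_sym n"
  shows "sortable n us w \<longleftrightarrow>
    \<not> (\<exists>i j k. i < j \<and> j < k \<and> j \<in> L_set c \<and> occurs_in_order w k i j) \<and>
    \<not> (\<exists>i j k. i < j \<and> j < k \<and> j \<in> R_set c \<and> occurs_in_order w j k i)"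
proof -
  note us = reduced_word_coxeter[OF assms(1-3)]
  \<comment> \<open>The strict inequalities of \<open>up_set_word_prod\<close> make the two sets
    complementary, so one set \<open>L\<close> in \<open>aligned\<close> encodes both sides.\<close>
  have "j \<in> L_set c \<longleftrightarrow> j \<in> up_set n us 0" "j \<in> R_set c \<longleftrightarrow> j \<notin> up_set n us 0" for j
    using up_set_word_prod[OF assms(1) us(1,2), of j] us(3)
    by (cases "j \<in> up_set n us 0"; simp add: L_set_def R_set_def)+
  then have "aligned (up_set n us 0) w \<longleftrightarrow>
    \<not> (\<exists>i j k. i < j \<and> j < k \<and> j \<in> L_set c \<and> occurs_in_order w k i j) \<and>
    \<not> (\<exists>i j k. i < j \<and> j < k \<and> j \<in> R_set c \<and> occurs_in_order w j k i)"
    unfolding aligned_def occurs_in_order_def by blast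
  then show ?thesis
    using sortable_iff_aligned[OF assms(1) us(1,2) assms(4)] by simp
qed

end
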